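(* For an elasticity tensor $C\in\mathcal C$ let $S$, $A$ be the scalars, $P_{ij}$, $Q_{ij}$ the traceless symmetric second-order tensors, and $R_{ijkl}$ the totally symmetric traceless fourth-order tensor associated with $C$ as in the context. Define seven functions on $\mathcal C$ by $$Z_1=S^2,\quad Z_2=AS,\quad Z_3=A^2,\quad Z_4=P_{ij}P_{ij},\quad Z_5=P_{ij}Q_{ij},\quad Z_6=Q_{ij}Q_{ij},\quad Z_7=R_{ijkl}R_{ijkl}.$$ Then $\{Z_1,\dots,Z_7\}$ is a basis of the space of quadratic invariants of the elasticity tensor; that is, each $Z_I$ is a quadratic invariant, every quadratic invariant of the elasticity tensor is a linear combination of $Z_1,\dots,Z_7$ with real coefficients (completeness), and $Z_1,\dots,Z_7$ are linearly independent as functions on $\mathcal C$.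
   Context: Indices run over $1,2,3$, rectangular (orthonormal) coordinates on Euclidean $\mathbb R^3$ are used, so the metric is $\delta_{ij}$ and upper and lower indices are not distinguished; repeated indices are summed. $\epsilon_{ijk}$ is the Levi-Civita symbol. The space $\mathcal C$ of elasticity tensors consists of all real arrays $C_{ijkl}$ with $C_{ijkl}=C_{jikl}=C_{klij}$ (hence also $C_{ijkl}=C_{ijlk}$). A quadratic invariant of the elasticity tensor is a function $I:\mathcal C\to\mathbb R$ of the form $I(C)=f_{ijklpqrs}C_{ijkl}C_{pqrs}$, where $f$ is a numerical tensor built from the metric, i.e. a real linear combination of tensors that are products of four Kronecker deltas in which the eight indices $i,j,k,l,p,q,r,s$ are distributed in some order. For $C\in\mathcal C$ let $$S_{ijkl}=\tfrac13(C_{ijkl}+C_{iklj}+C_{iljk}),\qquad A_{ijkl}=C_{ijkl}-S_{ijkl},$$ $$S_{ij}=S_{ijkk},\qquad S=S_{ii},\qquad P_{ij}=S_{ij}-\tfrac13S\,\delta_{ij},$$ $$R_{ijkl}=S_{ijkl}-\tfrac1{15}S(\delta_{ij}\delta_{kl}+\delta_{ik}\delta_{jl}+\delta_{il}\delta_{jk})-\tfrac17(P_{ij}\delta_{kl}+P_{ik}\delta_{jl}+P_{il}\delta_{jk}+P_{jk}\delta_{il}+P_{jl}\delta_{ik}+P_{kl}\delta_{ij}),$$ $$\Delta_{mn}=\tfrac13\epsilon_{mil}\epsilon_{njk}A_{ijkl},\qquad A=\Delta_{mm}\ \text{(a scalar)},\qquad Q_{ij}=\Delta_{ij}-\tfrac13A\,\delta_{ij}.$$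 *)

theory Defs
  imports Complex_Main "HOL-Library.Numeral_Type" "HOL-Combinatorics.Permutations"
begin

text \<open>
  The index type is the three-element type \<open>3\<close>; its elements are \<open>1\<close>, \<open>2\<close>, \<open>3\<close>
  (arithmetic is modulo three, so the literal \<open>3\<close> equals \<open>0\<close>).
\<close>

type_synonym tensor2 = "3 \<Rightarrow> 3 \<Rightarrow> real"
type_synonym tensor4 = "3 \<Rightarrow> 3 \<Rightarrow> 3 \<Rightarrow> 3 \<Rightarrow> real"
type_synonym tensor8 = "3 \<Rightarrow> 3 \<Rightarrow> 3 \<Rightarrow> 3 \<Rightarrow> 3 \<Rightarrow> 3 \<Rightarrow> 3 \<Rightarrow> 3 \<Rightarrow> real"

definition kdelta :: tensor2 where
  "kdelta i j = (if i = j then 1 else 0)"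

definition levi_civita :: "3 \<Rightarrow> 3 \<Rightarrow> 3 \<Rightarrow> real" where
  "levi_civita i j k =
    (if (i, j, k) \<in> {(1, 2, 3), (2, 3, 1), (3, 1, 2)} then 1
     else if (i, j, k) \<in> {(1, 3, 2), (3, 2, 1), (2, 1, 3)} then - 1
     else 0)"

definition elasticity_tensors :: "tensor4 set" where
  "elasticity_tensors =
    {C. \<forall>i j k l. C i j k l = C j i k l \<and> C i j k l = C k l i j}"

text \<open>
  The eight index slots are numbered \<open>0, \<dots>, 7\<close>. A permutation \<open>\<sigma>\<close> of the slots
  distributes the indices over four Kronecker deltas, the \<open>m\<close>-th of which carries the
  indices in the slots \<open>\<sigma> (2 m)\<close> and \<open>\<sigma> (2 m + 1)\<close>. Different permutations may
  give the same product, which is harmless for linear combinations.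
\<close>

definition delta_product :: "(nat \<Rightarrow> nat) \<Rightarrow> tensor8" where
  "delta_product \<sigma> i j k l p q r s =
    (let ind = [i, j, k, l, p, q, r, s]
     in \<Prod>m<4. kdelta (ind ! \<sigma> (2 * m)) (ind ! \<sigma> (2 * m + 1)))"

definition numerical_tensor8 :: "tensor8 \<Rightarrow> bool" where
  "numerical_tensor8 f \<longleftrightarrow>
    (\<exists>c :: (nat \<Rightarrow> nat) \<Rightarrow> real. \<forall>i j k l p q r s.
      f i j k l p q r s =
        (\<Sum>\<sigma> | \<sigma> permutes {..<8}. c \<sigma> * delta_product \<sigma> i j k l p q r s))"

text \<open>
  Functions on the space of elasticity tensors are represented by total functions on
  \<open>tensor4\<close>, of which only the values on \<^const>\<open>elasticity_tensors\<close> are relevant.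
\<close>

definition quadratic_invariant :: "(tensor4 \<Rightarrow> real) \<Rightarrow> bool" where
  "quadratic_invariant I \<longleftrightarrow>
    (\<exists>f. numerical_tensor8 f \<and>
      (\<forall>C\<in>elasticity_tensors.
        I C = (\<Sum>i\<in>UNIV. \<Sum>j\<in>UNIV. \<Sum>k\<in>UNIV. \<Sum>l\<in>UNIV.
               \<Sum>p\<in>UNIV. \<Sum>q\<in>UNIV. \<Sum>r\<in>UNIV. \<Sum>s\<in>UNIV.
                 f i j k l p q r s * C i j k l * C p q r s)))"

definition S4 :: "tensor4 \<Rightarrow> tensor4" where
  "S4 C i j k l = 1/3 * (C i j k l + C i k l j + C i l j k)"

definition A4 :: "tensor4 \<Rightarrow> tensor4" where
  "A4 C i j k l = C i j k l - S4 C i j k l"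

definition S2 :: "tensor4 \<Rightarrow> tensor2" where
  "S2 C i j = (\<Sum>k\<in>UNIV. S4 C i j k k)"

definition S0 :: "tensor4 \<Rightarrow> real" where
  "S0 C = (\<Sum>i\<in>UNIV. S2 C i i)"

definition P2 :: "tensor4 \<Rightarrow> tensor2" where
  "P2 C i j = S2 C i j - 1/3 * S0 C * kdelta i j"

definition R4 :: "tensor4 \<Rightarrow> tensor4" where
  "R4 C i j k l =
    S4 C i j k l
    - 1/15 * S0 C *
        (kdelta i j * kdelta k l + kdelta i k * kdelta j l + kdelta i l * kdelta j k)
    - 1/7 *
        (P2 C i j * kdelta k l + P2 C i k * kdelta j l + P2 C i l * kdelta j k
         + P2 C j k * kdelta i l + P2 C j l * kdelta i k + P2 C k l * kdelta i j)"

definition Delta2 :: "tensor4 \<Rightarrow> tensor2" where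
  "Delta2 C m n =
    1/3 * (\<Sum>i\<in>UNIV. \<Sum>j\<in>UNIV. \<Sum>k\<in>UNIV. \<Sum>l\<in>UNIV.
      levi_civita m i l * levi_civita n j k * A4 C i j k l)"

definition A0 :: "tensor4 \<Rightarrow> real" where
  "A0 C = (\<Sum>m\<in>UNIV. Delta2 C m m)"

definition Q2 :: "tensor4 \<Rightarrow> tensor2" where
  "Q2 C i j = Delta2 C i j - 1/3 * A0 C * kdelta i j"

definition Z1 :: "tensor4 \<Rightarrow> real" where
  "Z1 C = (S0 C)\<^sup>2"

definition Z2 :: "tensor4 \<Rightarrow> real" where
  "Z2 C = A0 C * S0 C"

definition Z3 :: "tensor4 \<Rightarrow> real" where
  "Z3 C = (A0 C)\<^sup>2"

definition Z4 :: "tensor4 \<Rightarrow> real" where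
  "Z4 C = (\<Sum>i\<in>UNIV. \<Sum>j\<in>UNIV. P2 C i j * P2 C i j)"

definition Z5 :: "tensor4 \<Rightarrow> real" where
  "Z5 C = (\<Sum>i\<in>UNIV. \<Sum>j\<in>UNIV. P2 C i j * Q2 C i j)"

definition Z6 :: "tensor4 \<Rightarrow> real" where
  "Z6 C = (\<Sum>i\<in>UNIV. \<Sum>j\<in>UNIV. Q2 C i j * Q2 C i j)"

definition Z7 :: "tensor4 \<Rightarrow> real" where
  "Z7 C = (\<Sum>i\<in>UNIV. \<Sum>j\<in>UNIV. \<Sum>k\<in>UNIV. \<Sum>l\<in>UNIV. R4 C i j k l * R4 C i j k l)"

end

theory Submission
  imports Defs "HOL-Analysis.Cartesian_Space"
begin

text \<open>
  A product of four deltas amounts to a perfect matching of the eight slots of \<open>C \<otimes> C\<close>. By the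
  symmetries of \<open>C\<close>, each of the 105 matchings contracts to one of eight invariants, built from
  \<open>T\<^sub>i\<^sub>j = C\<^sub>i\<^sub>j\<^sub>k\<^sub>k\<close>, \<open>V\<^sub>i\<^sub>j = C\<^sub>i\<^sub>k\<^sub>j\<^sub>k\<close> and their traces \<open>t\<close>, \<open>v\<close>: the products \<open>t\<^sup>2\<close>, \<open>t v\<close>, \<open>v\<^sup>2\<close>,
  \<open>T\<^sub>i\<^sub>jT\<^sub>i\<^sub>j\<close>, \<open>T\<^sub>i\<^sub>jV\<^sub>i\<^sub>j\<close>, \<open>V\<^sub>i\<^sub>jV\<^sub>i\<^sub>j\<close>, \<open>C\<^sub>i\<^sub>j\<^sub>k\<^sub>lC\<^sub>i\<^sub>j\<^sub>k\<^sub>l\<close> and \<open>C\<^sub>i\<^sub>j\<^sub>k\<^sub>lC\<^sub>i\<^sub>k\<^sub>j\<^sub>l\<close>. In dimension three the last one depends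
  linearly on the others, and the first seven are related to \<open>Z\<^sub>1, \<dots>, Z\<^sub>7\<close> by an invertible linear
  transformation. Linear independence is seen on seven products of simple second-order tensors.
\<close>

section \<open>Contractions of \<open>C\<close> with itself and perfect matchings of the eight
  slots\<close>

definition contract :: "tensor8 \<Rightarrow> tensor4 \<Rightarrow> real" where
  "contract f C = (\<Sum>i\<in>UNIV. \<Sum>j\<in>UNIV. \<Sum>k\<in>UNIV. \<Sum>l\<in>UNIV.
     \<Sum>p\<in>UNIV. \<Sum>q\<in>UNIV. \<Sum>r\<in>UNIV. \<Sum>s\<in>UNIV.
       f i j k l p q r s * C i j k l * C p q r s)"

definition dilatation :: "tensor4 \<Rightarrow> tensor2" where
  "dilatation C i j = (\<Sum>k\<in>UNIV. C i j k k)"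

definition voigt :: "tensor4 \<Rightarrow> tensor2" where
  "voigt C i j = (\<Sum>k\<in>UNIV. C i k j k)"

definition trace2 :: "tensor2 \<Rightarrow> real" where
  "trace2 M = (\<Sum>i\<in>UNIV. M i i)"

definition inner2 :: "tensor2 \<Rightarrow> tensor2 \<Rightarrow> real" where
  "inner2 M N = (\<Sum>i\<in>UNIV. \<Sum>j\<in>UNIV. M i j * N i j)"

definition inner4 :: "tensor4 \<Rightarrow> tensor4 \<Rightarrow> real" where
  "inner4 M N = (\<Sum>i\<in>UNIV. \<Sum>j\<in>UNIV. \<Sum>k\<in>UNIV. \<Sum>l\<in>UNIV. M i j k l * N i j k l)"

text \<open>
  For the slots listed in decreasing order every pair carries its larger slot first, and the pairs
  come in decreasing order of that slot. A nested sum over the slots is thus constrained first in its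
  innermost variable, which is what \<open>sum_if_eq_conj\<close> below eliminates.
\<close>

fun matchings :: "nat list \<Rightarrow> (nat \<times> nat) list list" where
  "matchings [] = [[]]"
| "matchings (x # xs) = concat (map (\<lambda>y. map ((#) (x, y)) (matchings (removeAll y xs))) xs)"

text \<open>An involution without fixed points is a perfect matching by its orbits: the head
  \<open>z\<close> is paired with \<open>p z\<close>, and \<open>p\<close>, being its own inverse,
  maps the remaining slots to themselves. Invariance of \<open>x\<close> under \<open>p\<close>
  states each pair's equation twice; the list states it once.\<close>

lemma fixpoint_free_involution_matching:
  assumes "distinct xs"
    and "\<And>a. a \<in> set xs \<Longrightarrow> p a \<in> set xs"
    and "\<And>a. a \<in> set xs \<Longrightarrow> p (p a) = a"
    and "\<And>a. a \<in> set xs \<Longrightarrow> p a \<noteq> a"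
  shows "\<exists>ps\<in>set (matchings xs). \<forall>x :: nat \<Rightarrow> 'a.
    (\<forall>a\<in>set xs. x (p a) = x a) \<longleftrightarrow> (\<forall>(a, b)\<in>set ps. x b = x a)"
  using assms
proof (induction xs rule: matchings.induct)
  case 1
  then show ?case by simp
next
  case (2 z zs)
  let ?ys = "removeAll (p z) zs"
  have pz: "p z \<in> set zs"
    using "2.prems"(2,4)[of z] by auto
  have ys: "p a \<in> set ?ys" if "a \<in> set ?ys" for a
  proof -
    have a: "a \<in> set zs" "a \<noteq> p z" "a \<noteq> z"
      using that "2.prems"(1) by auto
    have "p (p a) = a" "p (p z) = z"
      using a(1) by (simp_all add: "2.prems"(3))
    then have "p a \<noteq> z" "p a \<noteq> p z"
      using a(2,3) by metis+
    then show ?thesis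
      using a(1) "2.prems"(2)[of a] by simp
  qed
  have "\<exists>ps\<in>set (matchings ?ys). \<forall>x :: nat \<Rightarrow> 'a.
      (\<forall>a\<in>set ?ys. x (p a) = x a) \<longleftrightarrow> (\<forall>(a, b)\<in>set ps. x b = x a)"
    using "2.prems" ys by (intro "2.IH"[OF pz]) (auto simp: distinct_removeAll)
  then obtain ps where ps: "ps \<in> set (matchings ?ys)"
    "\<And>x :: nat \<Rightarrow> 'a. (\<forall>a\<in>set ?ys. x (p a) = x a) \<longleftrightarrow> (\<forall>(a, b)\<in>set ps. x b = x a)"
    by blast
  have "(\<forall>a\<in>set (z # zs). x (p a) = x a) \<longleftrightarrow> (\<forall>(a, b)\<in>set ((z, p z) # ps). x b = x a)"
    for x :: "nat \<Rightarrow> 'a"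
  proof -
    have "set (z # zs) = insert z (insert (p z) (set ?ys))"
      using pz by auto
    then show ?thesis
      using ps(2)[of x] "2.prems"(3)[of z] by auto
  qed
  moreover have "(z, p z) # ps \<in> set (matchings (z # zs))"
    using pz ps(1) by auto
  ultimately show ?case by blast
qed

lemma prod_kdelta:
  assumes "finite A"
  shows "(\<Prod>m\<in>A. kdelta (f m) (g m)) = (if \<forall>m\<in>A. f m = g m then 1 else 0)"
  using assms by (induction rule: finite_induct) (auto simp: kdelta_def)

text \<open>The map \<open>flip\<close> exchanges 2m and 2m+1, the two positions of one delta. Its
  conjugate by \<sigma> sends each slot to the slot joined to it by a delta, which is an involution
  without fixed points.\<close>

lemma permutation_matching:
  assumes "\<sigma> permutes {..<8}"
  shows "\<exists>ps\<in>set (matchings (rev [0..<8])). \<forall>x :: nat \<Rightarrow> 'a.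
    (\<forall>m<4. x (\<sigma> (2 * m)) = x (\<sigma> (2 * m + 1))) \<longleftrightarrow> (\<forall>(a, b)\<in>set ps. x b = x a)"
proof -
  define flip :: "nat \<Rightarrow> nat" where "flip m = (if even m then m + 1 else m - 1)" for m
  define p where "p = \<sigma> \<circ> flip \<circ> inv \<sigma>"
  have flip: "flip m < 8" "flip m \<noteq> m" "flip (flip m) = m" if "m < 8" for m
    using that by (auto simp: flip_def elim!: evenE oddE)
  have ex: "\<exists>m<8. n = \<sigma> m" if "n < 8" for n
    using permutes_image[OF assms] that by (auto simp: set_eq_iff image_iff)
  have p\<sigma>: "p (\<sigma> m) = \<sigma> (flip m)" for m
    using assms by (simp add: p_def permutes_inverses)
  have \<sigma>: "\<sigma> m < 8 \<longleftrightarrow> m < 8" "\<sigma> m = \<sigma> m' \<longleftrightarrow> m = m'" for m m'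
    using permutes_in_image[OF assms, of m] permutes_inj[OF assms] by (auto dest: injD)
  have "p a < 8" "p (p a) = a" "p a \<noteq> a" if "a < 8" for a
    using ex[OF that] flip by (auto simp: p\<sigma> \<sigma>)
  then have "\<exists>ps\<in>set (matchings (rev [0..<8])). \<forall>x :: nat \<Rightarrow> 'a.
    (\<forall>a\<in>set (rev [0..<8]). x (p a) = x a) \<longleftrightarrow> (\<forall>(a, b)\<in>set ps. x b = x a)"
    by (intro fixpoint_free_involution_matching) auto
  moreover have "(\<forall>a\<in>set (rev [0..<8]). x (p a) = x a) \<longleftrightarrow>
      (\<forall>m<4. x (\<sigma> (2 * m)) = x (\<sigma> (2 * m + 1)))" for x :: "nat \<Rightarrow> 'a"
  proof -
    have "(\<forall>a\<in>set (rev [0..<8]). x (p a) = x a) \<longleftrightarrow> (\<forall>a<8. x (p a) = x a)"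
      by auto
    also have "\<dots> \<longleftrightarrow> (\<forall>m<8. x (\<sigma> (flip m)) = x (\<sigma> m))"
      using ex \<sigma>(1) p\<sigma> by metis
    also have "\<dots> \<longleftrightarrow> (\<forall>m<4. x (\<sigma> (2 * m)) = x (\<sigma> (2 * m + 1)))"
    proof safe
      fix m :: nat assume "\<forall>m<8. x (\<sigma> (flip m)) = x (\<sigma> m)" "m < 4"
      then show "x (\<sigma> (2 * m)) = x (\<sigma> (2 * m + 1))"
        by (auto simp: flip_def dest: spec[of _ "2 * m"])
    next
      fix m :: nat assume *: "\<forall>m<4. x (\<sigma> (2 * m)) = x (\<sigma> (2 * m + 1))" "m < 8"
      then show "x (\<sigma> (flip m)) = x (\<sigma> m)"
        by (cases "even m") (auto simp: flip_def elim!: evenE oddE)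
    qed
    finally show ?thesis .
  qed
  ultimately show ?thesis by simp
qed

text \<open>The deltas are merged into one condition so that they can be eliminated by rewriting.
  When the larger slot \<open>a\<close> comes first, each equation has the outer variable on the
  left and the inner one on the right, as \<open>sum_if_eq_conj\<close> expects.\<close>

definition contract_matching :: "(nat \<times> nat) list \<Rightarrow> tensor4 \<Rightarrow> real" where
  "contract_matching ps C =
    (\<Sum>i\<in>UNIV. \<Sum>j\<in>UNIV. \<Sum>k\<in>UNIV. \<Sum>l\<in>UNIV. \<Sum>p\<in>UNIV. \<Sum>q\<in>UNIV. \<Sum>r\<in>UNIV. \<Sum>s\<in>UNIV.
       if \<forall>(a, b)\<in>set ps. [i, j, k, l, p, q, r, s] ! b = [i, j, k, l, p, q, r, s] ! a
       then C i j k l * C p q r s else 0)"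

lemma contract_delta_product:
  assumes "\<And>x :: nat \<Rightarrow> 3. (\<forall>m<4. x (\<sigma> (2 * m)) = x (\<sigma> (2 * m + 1))) \<longleftrightarrow> (\<forall>(a, b)\<in>set ps. x b = x a)"
  shows "contract (delta_product \<sigma>) C = contract_matching ps C"
proof -
  have "delta_product \<sigma> i j k l p q r s =
      (if \<forall>(a, b)\<in>set ps. [i, j, k, l, p, q, r, s] ! b = [i, j, k, l, p, q, r, s] ! a
       then 1 else 0)" for i j k l p q r s
    unfolding delta_product_def Let_def prod_kdelta[OF finite_lessThan]
    using assms[of "\<lambda>n. [i, j, k, l, p, q, r, s] ! n"] by (simp add: Ball_def)
  then show ?thesis
    unfolding contract_def contract_matching_def by (intro sum.cong refl) auto
qed

lemma sum_if_eq_conj: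
  "(\<Sum>x\<in>UNIV. if a = x \<and> P x then F x else 0) = (if P a then F a else (0::real))"
  for a :: "'a::finite"
proof -
  have "(\<Sum>x\<in>UNIV. if a = x \<and> P x then F x else 0) = (\<Sum>x\<in>UNIV. if a = x then (if P x then F x else 0) else 0)"
    by (intro sum.cong) auto
  then show ?thesis by simp
qed

lemma sum_if_const: "(\<Sum>x\<in>A. if P then F x else 0) = (if P then \<Sum>x\<in>A. F x else (0::real))"
  by simp

lemma sum_swap_factor:
  "(\<Sum>x\<in>A. \<Sum>y\<in>B. f x y * g y) = (\<Sum>y\<in>B. (\<Sum>x\<in>A. f x y) * (g y :: real))"
  by (subst sum.swap) (simp add: sum_distrib_right)

lemma sum_swap_factor2:
  "(\<Sum>x\<in>A. \<Sum>y\<in>B. \<Sum>z\<in>D. f x y z * g y z) = (\<Sum>y\<in>B. \<Sum>z\<in>D. (\<Sum>x\<in>A. f x y z) * (g y z :: real))"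
  by (subst sum.swap) (simp add: sum_swap_factor)

section \<open>Reduction of all matchings to eight basic invariants\<close>

lemma elasticity_symmetries:
  assumes "C \<in> elasticity_tensors"
  shows "C i j k l = C j i k l" "C i j k l = C i j l k" "C i j k l = C k l i j"
proof -
  show 1: "C i j k l = C j i k l" and 2: "C i j k l = C k l i j" for i j k l
    using assms unfolding elasticity_tensors_def by blast+
  show "C i j k l = C i j l k"
    using 1[of k l] 2 by metis
qed

lemma dilatation_folds:
  assumes "C \<in> elasticity_tensors"
  shows "(\<Sum>k\<in>UNIV. C i j k k) = dilatation C i j" "(\<Sum>k\<in>UNIV. C k k i j) = dilatation C i j"
  unfolding dilatation_def using elasticity_symmetries(3)[OF assms] by simp_all

lemma voigt_folds:
  assumes "C \<in> elasticity_tensors"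
  shows "(\<Sum>k\<in>UNIV. C i k j k) = voigt C i j" "(\<Sum>k\<in>UNIV. C k i k j) = voigt C i j"
    "(\<Sum>k\<in>UNIV. C i k k j) = voigt C i j" "(\<Sum>k\<in>UNIV. C k i j k) = voigt C i j"
  unfolding voigt_def
  using elasticity_symmetries(1)[OF assms] elasticity_symmetries(2)[OF assms]
  by (auto intro!: sum.cong)

lemma dilatation_sym:
  assumes "C \<in> elasticity_tensors"
  shows "dilatation C i j = dilatation C j i"
  unfolding dilatation_def using elasticity_symmetries(1)[OF assms] by (intro sum.cong) auto

lemma voigt_sym:
  assumes "C \<in> elasticity_tensors"
  shows "voigt C i j = voigt C j i"
  unfolding voigt_def using elasticity_symmetries(3)[OF assms] by (intro sum.cong) auto

definition "basic1 C = trace2 (dilatation C) * trace2 (dilatation C)"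
definition "basic2 C = trace2 (dilatation C) * trace2 (voigt C)"
definition "basic3 C = trace2 (voigt C) * trace2 (voigt C)"
definition "basic4 C = inner2 (dilatation C) (dilatation C)"
definition "basic5 C = inner2 (dilatation C) (voigt C)"
definition "basic6 C = inner2 (voigt C) (voigt C)"
definition "basic7 C = inner4 C C"
definition "basic8 C = inner4 C (\<lambda>i j k l. C i k j l)"

definition basic_invariant :: "(tensor4 \<Rightarrow> real) \<Rightarrow> bool" where
  "basic_invariant I \<longleftrightarrow>
    (\<exists>B\<in>{basic1, basic2, basic3, basic4, basic5, basic6, basic7, basic8}.
      \<forall>C\<in>elasticity_tensors. I C = B C)"

text \<open>Used as a congruence rule: it supplies the simplifier with
  \<open>C \<in> elasticity_tensors\<close> under the abstraction over \<open>C\<close>, which the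
  symmetry and folding rules have as premise.\<close>

lemma basic_invariant_cong:
  assumes "\<And>C. C \<in> elasticity_tensors \<Longrightarrow> I C = J C"
  shows "basic_invariant I \<longleftrightarrow> basic_invariant J"
  using assms by (simp add: basic_invariant_def)

lemma basic_invariant_basic:
  "basic_invariant basic1" "basic_invariant basic2" "basic_invariant basic3" "basic_invariant basic4"
  "basic_invariant basic5" "basic_invariant basic6" "basic_invariant basic7" "basic_invariant basic8"
  by (simp_all add: basic_invariant_def)

lemma trace2_folds:
  "(\<Sum>i\<in>UNIV. dilatation C i i) = trace2 (dilatation C)"
  "(\<Sum>i\<in>UNIV. voigt C i i) = trace2 (voigt C)"
  "trace2 (dilatation C) * trace2 (dilatation C) = basic1 C"
  "trace2 (dilatation C) * trace2 (voigt C) = basic2 C"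
  "trace2 (voigt C) * trace2 (dilatation C) = basic2 C"
  "trace2 (voigt C) * trace2 (voigt C) = basic3 C"
  by (simp_all add: trace2_def basic1_def basic2_def basic3_def)

lemma inner2_folds:
  "(\<Sum>i\<in>UNIV. \<Sum>j\<in>UNIV. dilatation C i j * dilatation C i j) = basic4 C"
  "(\<Sum>i\<in>UNIV. \<Sum>j\<in>UNIV. dilatation C i j * voigt C i j) = basic5 C"
  "(\<Sum>i\<in>UNIV. \<Sum>j\<in>UNIV. voigt C i j * dilatation C i j) = basic5 C"
  "(\<Sum>i\<in>UNIV. \<Sum>j\<in>UNIV. voigt C i j * voigt C i j) = basic6 C"
  by (simp_all add: inner2_def basic4_def basic5_def basic6_def mult.commute)

lemma inner4_folds:
  "(\<Sum>i\<in>UNIV. \<Sum>j\<in>UNIV. \<Sum>k\<in>UNIV. \<Sum>l\<in>UNIV. C i j k l * C i j k l) = basic7 C"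
  "(\<Sum>i\<in>UNIV. \<Sum>j\<in>UNIV. \<Sum>k\<in>UNIV. \<Sum>l\<in>UNIV. C i j k l * C i k j l) = basic8 C"
  by (simp_all add: inner4_def basic7_def basic8_def)

lemma inner4_fold_swap:
  assumes "C \<in> elasticity_tensors"
  shows "(\<Sum>i\<in>UNIV. \<Sum>j\<in>UNIV. \<Sum>k\<in>UNIV. \<Sum>l\<in>UNIV. C i j k l * C i l j k) = basic8 C"
  unfolding inner4_folds(2)[symmetric]
  by (subst (3) sum.swap) (simp add: elasticity_symmetries(2)[OF assms])

text \<open>
  The deltas are eliminated from the innermost sum outwards; partial traces are then recognised as
  \<^const>\<open>dilatation\<close> or \<^const>\<open>voigt\<close>, and a trace over an outer index is first moved inwards by the
  two \<open>sum_swap_factor\<close> rules.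
\<close>

lemmas contract_simps = contract_matching_def sum_if_eq_conj sum_if_const
  dilatation_folds voigt_folds trace2_folds inner2_folds inner4_folds inner4_fold_swap
  sum_distrib_left[symmetric] sum_distrib_right[symmetric] sum_swap_factor sum_swap_factor2
  dilatation_sym voigt_sym elasticity_symmetries

text \<open>Proved by enumeration: \<open>matchings\<close> unfolds to 7 * 5 * 3 = 105 pairings, and
  each contraction is rewritten until one of the eight basic invariants is left.\<close>

lemma matchings8:
  "\<forall>ps\<in>set (matchings (rev [0..<8])). basic_invariant (contract_matching ps)"
proof -
  have "rev [0..<8] = [7, 6, 5, 4, 3, 2, 1, 0 :: nat]"
    by (simp add: upt_rec)
  then show ?thesis
    by (simp add: contract_simps contract_matching_def[abs_def] basic_invariant_basic
        cong: if_cong basic_invariant_cong)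
qed

lemma basic_invariant_contract_delta_product:
  assumes "\<sigma> permutes {..<8}"
  shows "basic_invariant (contract (delta_product \<sigma>))"
proof -
  obtain ps where ps: "ps \<in> set (matchings (rev [0..<8]))"
    "\<And>x :: nat \<Rightarrow> 3. (\<forall>m<4. x (\<sigma> (2 * m)) = x (\<sigma> (2 * m + 1))) \<longleftrightarrow> (\<forall>(a, b)\<in>set ps. x b = x a)"
    using permutation_matching[OF assms] by blast
  have "contract (delta_product \<sigma>) = contract_matching ps"
    using contract_delta_product[OF ps(2)] by blast
  then show ?thesis
    using matchings8 ps(1) by simp
qed

section \<open>The vector space of quadratic invariants\<close>

lemma contract_add:
  "contract (\<lambda>i j k l p q r s. f i j k l p q r s + g i j k l p q r s) C = contract f C + contract g C"
  by (simp add: contract_def distrib_right sum.distrib)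

lemma contract_scale:
  "contract (\<lambda>i j k l p q r s. c * f i j k l p q r s) C = c * contract f C"
  by (simp add: contract_def sum_distrib_left mult.assoc)

lemma contract_sum:
  assumes "finite A"
  shows "contract (\<lambda>i j k l p q r s. \<Sum>x\<in>A. c x * f x i j k l p q r s) C = (\<Sum>x\<in>A. c x * contract (f x) C)"
  using assms
proof (induction rule: finite_induct)
  case empty
  then show ?case by (simp add: contract_def)
next
  case (insert x A)
  then show ?case
    by (simp add: contract_add contract_scale)
qed

text \<open>Contraction is linear in the coefficient tensor, so the tensor can be traded for scalar
  coefficients of the delta contractions. Closure under linear combinations then becomes arithmetic
  on these coefficients.\<close>

lemma quadratic_invariant_iff:
  "quadratic_invariant I \<longleftrightarrow> (\<exists>c. \<forall>C\<in>elasticity_tensors.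
     I C = (\<Sum>\<sigma> | \<sigma> permutes {..<8}. c \<sigma> * contract (delta_product \<sigma>) C))"
proof
  assume "quadratic_invariant I"
  then obtain f c where c: "\<And>i j k l p q r s. f i j k l p q r s =
        (\<Sum>\<sigma> | \<sigma> permutes {..<8}. c \<sigma> * delta_product \<sigma> i j k l p q r s)"
      and I: "\<And>C. C \<in> elasticity_tensors \<Longrightarrow> I C = contract f C"
    unfolding quadratic_invariant_def numerical_tensor8_def contract_def by blast
  have "f = (\<lambda>i j k l p q r s. \<Sum>\<sigma> | \<sigma> permutes {..<8}. c \<sigma> * delta_product \<sigma> i j k l p q r s)"
    by (intro ext c)
  then show "\<exists>c. \<forall>C\<in>elasticity_tensors.
     I C = (\<Sum>\<sigma> | \<sigma> permutes {..<8}. c \<sigma> * contract (delta_product \<sigma>) C)"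
    using I contract_sum[OF finite_permutations[OF finite_lessThan]] by auto
next
  assume "\<exists>c. \<forall>C\<in>elasticity_tensors.
     I C = (\<Sum>\<sigma> | \<sigma> permutes {..<8}. c \<sigma> * contract (delta_product \<sigma>) C)"
  then obtain c where c: "\<And>C. C \<in> elasticity_tensors \<Longrightarrow>
      I C = (\<Sum>\<sigma> | \<sigma> permutes {..<8}. c \<sigma> * contract (delta_product \<sigma>) C)"
    by blast
  define f where "f = (\<lambda>i j k l p q r s. \<Sum>\<sigma> | \<sigma> permutes {..<8}. c \<sigma> * delta_product \<sigma> i j k l p q r s)"
  have "numerical_tensor8 f"
    unfolding numerical_tensor8_def f_def by blast
  moreover have "I C = contract f C" if "C \<in> elasticity_tensors" for C
    unfolding f_def contract_sum[OF finite_permutations[OF finite_lessThan]] using c[OF that] .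
  ultimately show "quadratic_invariant I"
    unfolding quadratic_invariant_def contract_def by blast
qed

lemma quadratic_invariant_cong:
  assumes "\<And>C. C \<in> elasticity_tensors \<Longrightarrow> I C = J C"
  shows "quadratic_invariant I \<longleftrightarrow> quadratic_invariant J"
  using assms by (simp add: quadratic_invariant_def)

lemma quadratic_invariant_add:
  assumes "quadratic_invariant I" "quadratic_invariant J"
  shows "quadratic_invariant (\<lambda>C. I C + J C)"
proof -
  obtain c d where
    "\<forall>C\<in>elasticity_tensors. I C = (\<Sum>\<sigma> | \<sigma> permutes {..<8}. c \<sigma> * contract (delta_product \<sigma>) C)"
    "\<forall>C\<in>elasticity_tensors. J C = (\<Sum>\<sigma> | \<sigma> permutes {..<8}. d \<sigma> * contract (delta_product \<sigma>) C)"
    using assms unfolding quadratic_invariant_iff by blast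
  then show ?thesis
    unfolding quadratic_invariant_iff
    by (intro exI[of _ "\<lambda>\<sigma>. c \<sigma> + d \<sigma>"]) (simp add: distrib_right sum.distrib)
qed

lemma quadratic_invariant_scale:
  assumes "quadratic_invariant I"
  shows "quadratic_invariant (\<lambda>C. a * I C)"
proof -
  obtain c where
    "\<forall>C\<in>elasticity_tensors. I C = (\<Sum>\<sigma> | \<sigma> permutes {..<8}. c \<sigma> * contract (delta_product \<sigma>) C)"
    using assms unfolding quadratic_invariant_iff by blast
  then show ?thesis
    unfolding quadratic_invariant_iff
    by (intro exI[of _ "\<lambda>\<sigma>. a * c \<sigma>"]) (simp add: sum_distrib_left mult.assoc)
qed

lemma quadratic_invariant_delta_product:
  assumes "\<sigma> permutes {..<8}"
  shows "quadratic_invariant (contract (delta_product \<sigma>))"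
  unfolding quadratic_invariant_iff using assms
  by (intro exI[of _ "\<lambda>\<tau>. if \<tau> = \<sigma> then 1 else 0"])
     (simp add: if_distrib[of "\<lambda>x. x * _"] finite_permutations cong: if_cong)

lemma permutes_nth:
  assumes "distinct xs" "set xs = {..<length xs}"
  shows "(\<lambda>n. if n < length xs then xs ! n else n) permutes {..<length xs}"
proof (rule bij_imp_permutes)
  have "bij_betw ((!) xs) {..<length xs} {..<length xs}"
    using assms by (intro bij_betw_nth) auto
  then show "bij_betw (\<lambda>n. if n < length xs then xs ! n else n) {..<length xs} {..<length xs}"
    by (rule bij_betw_cong[THEN iffD1, rotated]) auto
qed auto

text \<open>Converse direction of the translation: the list of slots is read as the one-line
  notation of a permutation, whose consecutive entries are the pairs.\<close>

lemma quadratic_invariant_contract_matching: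
  assumes "distinct [a, b, c, d, e, f, g, h]" "set [a, b, c, d, e, f, g, h] \<subseteq> {..<8}"
  shows "quadratic_invariant (contract_matching [(b, a), (d, c), (f, e), (h, g)])"
proof -
  let ?xs = "[a, b, c, d, e, f, g, h]"
  define \<sigma> where "\<sigma> n = (if n < length ?xs then ?xs ! n else n)" for n
  have "set ?xs = {..<length ?xs}"
    using assms distinct_card[OF assms(1)] by (intro card_subset_eq) simp_all
  then have "\<sigma> permutes {..<length ?xs}"
    unfolding \<sigma>_def by (rule permutes_nth[OF assms(1)])
  moreover have "length ?xs = 8"
    by simp
  ultimately have "\<sigma> permutes {..<8}"
    by metis
  moreover have "(\<forall>m<4. x (\<sigma> (2 * m)) = x (\<sigma> (2 * m + 1))) \<longleftrightarrow>
      (\<forall>(a, b)\<in>set [(b, a), (d, c), (f, e), (h, g)]. x b = x a)" for x :: "nat \<Rightarrow> 3"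
    unfolding \<sigma>_def by (simp add: numeral_eq_Suc All_less_Suc conj_commute conj_left_commute)
  then have "contract (delta_product \<sigma>) = contract_matching [(b, a), (d, c), (f, e), (h, g)]"
    by (intro ext contract_delta_product)
  ultimately show ?thesis
    using quadratic_invariant_delta_product[of \<sigma>] by simp
qed

lemma quadratic_invariant_basic:
  "quadratic_invariant basic1" "quadratic_invariant basic2" "quadratic_invariant basic3"
  "quadratic_invariant basic4" "quadratic_invariant basic5" "quadratic_invariant basic6"
  "quadratic_invariant basic7"
proof -
  \<comment> \<open>Slots 0 to 3 belong to the first factor \<open>C\<close>, slots 4 to 7 to the
    second. Pairs inside a factor produce traces, pairs across the factors produce inner
    products.\<close>
  have 1: "contract_matching [(7, 6), (5, 4), (3, 2), (1, 0)] C = basic1 C"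
    and 2: "contract_matching [(7, 5), (6, 4), (3, 2), (1, 0)] C = basic2 C"
    and 3: "contract_matching [(7, 5), (6, 4), (3, 1), (2, 0)] C = basic3 C"
    and 4: "contract_matching [(7, 6), (5, 1), (4, 0), (3, 2)] C = basic4 C"
    and 5: "contract_matching [(7, 5), (6, 1), (4, 0), (3, 2)] C = basic5 C"
    and 6: "contract_matching [(7, 5), (6, 2), (4, 0), (3, 1)] C = basic6 C"
    and 7: "contract_matching [(7, 3), (6, 2), (5, 1), (4, 0)] C = basic7 C"
    if "C \<in> elasticity_tensors" for C
    using that by (simp_all add: contract_simps cong: if_cong)
  show "quadratic_invariant basic1" "quadratic_invariant basic2" "quadratic_invariant basic3"
    "quadratic_invariant basic4" "quadratic_invariant basic5" "quadratic_invariant basic6"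
    "quadratic_invariant basic7"
    by ((subst quadratic_invariant_cong[symmetric], erule 1 2 3 4 5 6 7,
        rule quadratic_invariant_contract_matching; simp)+)
qed

section \<open>Expansion of the invariants Z in the basic invariants\<close>

lemma S2_eq:
  assumes "C \<in> elasticity_tensors"
  shows "S2 C i j = (dilatation C i j + 2 * voigt C i j) / 3"
  by (simp add: S2_def S4_def sum.distrib sum_divide_distrib[symmetric]
      dilatation_folds[OF assms] voigt_folds[OF assms])

lemma S0_eq:
  assumes "C \<in> elasticity_tensors"
  shows "S0 C = (trace2 (dilatation C) + 2 * trace2 (voigt C)) / 3"
  by (simp add: S0_def S2_eq[OF assms] trace2_def sum.distrib sum_divide_distrib[symmetric]
      sum_distrib_left[symmetric])

text \<open>A product of two Levi-Civita symbols is a determinant of deltas, so only traces of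
  \<open>A4 C\<close> survive, and these reduce to \<open>dilatation\<close> and
  \<open>voigt\<close>. The proof compares the nine components directly.\<close>

lemma Delta2_eq:
  assumes "C \<in> elasticity_tensors"
  shows "Delta2 C m n = 2 / 3 * (voigt C m n - dilatation C m n)
    + (trace2 (dilatation C) - trace2 (voigt C)) / 3 * kdelta m n"
proof -
  have "\<forall>m n. Delta2 C m n = 2 / 3 * (voigt C m n - dilatation C m n)
    + (trace2 (dilatation C) - trace2 (voigt C)) / 3 * kdelta m n"
    by (simp add: forall_3 Delta2_def sum_3 levi_civita_def A4_def S4_def voigt_def dilatation_def
      trace2_def kdelta_def elasticity_symmetries[OF assms]) (simp add: field_simps)
  then show ?thesis by blast
qed

lemma A0_eq:
  assumes "C \<in> elasticity_tensors"
  shows "A0 C = (trace2 (dilatation C) - trace2 (voigt C)) / 3"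
  by (simp add: A0_def Delta2_eq[OF assms] sum_3 trace2_def kdelta_def field_simps)

lemma P2_eq:
  assumes "C \<in> elasticity_tensors"
  shows "P2 C i j = (dilatation C i j + 2 * voigt C i j) / 3
    - (trace2 (dilatation C) + 2 * trace2 (voigt C)) / 9 * kdelta i j"
  by (simp add: P2_def S2_eq[OF assms] S0_eq[OF assms])

lemma Q2_eq:
  assumes "C \<in> elasticity_tensors"
  shows "Q2 C i j = 2 / 3 * (voigt C i j - dilatation C i j)
    + 2 * (trace2 (dilatation C) - trace2 (voigt C)) / 9 * kdelta i j"
  by (simp add: Q2_def Delta2_eq[OF assms] A0_eq[OF assms] field_simps)

lemma Z1_eq_basic:
  assumes "C \<in> elasticity_tensors"
  shows "Z1 C = 1/9 * basic1 C + 4/9 * basic2 C + 4/9 * basic3 C"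
  by (simp add: Z1_def S0_eq[OF assms] basic1_def basic2_def basic3_def power2_eq_square field_simps)

lemma Z2_eq_basic:
  assumes "C \<in> elasticity_tensors"
  shows "Z2 C = 1/9 * basic1 C + 1/9 * basic2 C + (-2/9) * basic3 C"
  by (simp add: Z2_def S0_eq[OF assms] A0_eq[OF assms] basic1_def basic2_def basic3_def field_simps)

lemma Z3_eq_basic:
  assumes "C \<in> elasticity_tensors"
  shows "Z3 C = 1/9 * basic1 C + (-2/9) * basic2 C + 1/9 * basic3 C"
  by (simp add: Z3_def A0_eq[OF assms] basic1_def basic2_def basic3_def power2_eq_square field_simps)

text \<open>Bilinearity: pairing with \<open>kdelta\<close> gives a trace, and \<open>kdelta\<close>
  paired with itself gives the dimension 3. One expansion thus serves \<open>Z4\<close>,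
  \<open>Z5\<close> and \<open>Z6\<close>.\<close>

lemma inner2_combination:
  assumes "\<And>i j. M i j = a * X i j + b * Y i j + c * kdelta i j"
    and "\<And>i j. N i j = a' * X i j + b' * Y i j + c' * kdelta i j"
  shows "inner2 M N = a * a' * inner2 X X + (a * b' + b * a') * inner2 X Y + b * b' * inner2 Y Y
    + (a * c' + c * a') * trace2 X + (b * c' + c * b') * trace2 Y + 3 * c * c'"
  unfolding inner2_def trace2_def assms sum_3 by (simp add: kdelta_def algebra_simps)

lemma
  assumes "C \<in> elasticity_tensors"
  shows Z4_eq_basic: "Z4 C = (-1/27) * basic1 C + (-4/27) * basic2 C + (-4/27) * basic3 C
      + 1/9 * basic4 C + 4/9 * basic5 C + 4/9 * basic6 C"
    and Z5_eq_basic: "Z5 C = 2/27 * basic1 C + 2/27 * basic2 C + (-4/27) * basic3 C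
      + (-2/9) * basic4 C + (-2/9) * basic5 C + 4/9 * basic6 C"
    and Z6_eq_basic: "Z6 C = (-4/27) * basic1 C + 8/27 * basic2 C + (-4/27) * basic3 C
      + 4/9 * basic4 C + (-8/9) * basic5 C + 4/9 * basic6 C"
proof -
  let ?t = "trace2 (dilatation C)" and ?v = "trace2 (voigt C)"
  have P: "P2 C i j = 1/3 * dilatation C i j + 2/3 * voigt C i j + (- ?t / 9 - 2 * ?v / 9) * kdelta i j"
    and Q: "Q2 C i j = (-2/3) * dilatation C i j + 2/3 * voigt C i j + (2 * ?t / 9 - 2 * ?v / 9) * kdelta i j"
    for i j
    by (simp_all add: P2_eq[OF assms] Q2_eq[OF assms] field_simps)
  note basic_defs = basic1_def basic2_def basic3_def basic4_def basic5_def basic6_def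
  show "Z4 C = (-1/27) * basic1 C + (-4/27) * basic2 C + (-4/27) * basic3 C
      + 1/9 * basic4 C + 4/9 * basic5 C + 4/9 * basic6 C"
    unfolding Z4_def inner2_def[symmetric] inner2_combination[OF P P] basic_defs
    by (simp add: field_simps)
  show "Z5 C = 2/27 * basic1 C + 2/27 * basic2 C + (-4/27) * basic3 C
      + (-2/9) * basic4 C + (-2/9) * basic5 C + 4/9 * basic6 C"
    unfolding Z5_def inner2_def[symmetric] inner2_combination[OF P Q] basic_defs
    by (simp add: field_simps)
  show "Z6 C = (-4/27) * basic1 C + 8/27 * basic2 C + (-4/27) * basic3 C
      + 4/9 * basic4 C + (-8/9) * basic5 C + 4/9 * basic6 C"
    unfolding Z6_def inner2_def[symmetric] inner2_combination[OF Q Q] basic_defs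
    by (simp add: field_simps)
qed

text \<open>
  This relation is special to dimension three: it says that the part of \<open>C\<close> with vanishing total
  symmetrisation has no traceless component.
\<close>

lemma basic8_eq:
  assumes "C \<in> elasticity_tensors"
  shows "basic8 C = basic7 C - 2 * (basic4 C - 2 * basic5 C + basic6 C)
    + 1/2 * (basic1 C - 2 * basic2 C + basic3 C)"
  unfolding basic1_def basic2_def basic3_def basic4_def basic5_def basic6_def basic7_def basic8_def
    inner4_def inner2_def trace2_def dilatation_def voigt_def sum_3
  by (simp add: elasticity_symmetries[OF assms] algebra_simps)

lemma S4_sym:
  assumes "C \<in> elasticity_tensors"
  shows "S4 C i j k l = S4 C j i k l" "S4 C i j k l = S4 C i k j l" "S4 C i j k l = S4 C i j l k"
  by (simp_all add: S4_def elasticity_symmetries[OF assms])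

text \<open>Squaring the three-term sum in \<open>S4\<close> gives, with prefactor 1/9, three
  squares equal to \<open>basic7\<close> and six cross terms equal to \<open>basic8\<close>.\<close>

lemma inner4_S4:
  assumes "C \<in> elasticity_tensors"
  shows "inner4 (S4 C) (S4 C) = 1/3 * basic7 C + 2/3 * basic8 C"
  unfolding inner4_def S4_def basic7_def basic8_def sum_3
  by (simp add: elasticity_symmetries[OF assms] algebra_simps)

text \<open>This is the part that \<open>R4 C\<close> removes from \<open>S4 C\<close>, for
  \<open>a = S0 C / 15\<close> and \<open>p\<close> equal to \<open>P2 C\<close> divided by
  7.\<close>

definition trace_part :: "real \<Rightarrow> tensor2 \<Rightarrow> tensor4" where
  "trace_part a p i j k l =
    a * (kdelta i j * kdelta k l + kdelta i k * kdelta j l + kdelta i l * kdelta j k)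
    + (p i j * kdelta k l + p i k * kdelta j l + p i l * kdelta j k
       + p j k * kdelta i l + p j l * kdelta i k + p k l * kdelta i j)"

text \<open>By total symmetry of \<open>s\<close>, the three products of deltas all give the double
  trace of \<open>s\<close>, and the six terms with \<open>p\<close> all pair the single trace of
  \<open>s\<close> with \<open>p\<close>.\<close>

lemma inner4_trace_part:
  assumes "\<And>i j k l. s i j k l = s j i k l" "\<And>i j k l. s i j k l = s i k j l"
    "\<And>i j k l. s i j k l = s i j l k" "\<And>i j. p i j = p j i"
  shows "inner4 s (trace_part a p) =
    3 * a * trace2 (\<lambda>i j. \<Sum>k\<in>UNIV. s i j k k) + 6 * inner2 (\<lambda>i j. \<Sum>k\<in>UNIV. s i j k k) p"
  unfolding inner4_def trace_part_def trace2_def inner2_def sum_3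
  by (simp add: kdelta_def assms(1-3) assms(4)[of 2 1] assms(4)[of 3 1] assms(4)[of 3 2] algebra_simps)

text \<open>The factors are 5 = 3 + 2 and 7 = 3 + 4 in dimension three. They account for the
  constants 1/15 and 1/7 in \<open>R4\<close>, which make the trace of the removed part equal to
  that of \<open>S4 C\<close>.\<close>

lemma trace_trace_part:
  assumes "\<And>i j. p i j = p j i" "trace2 p = 0"
  shows "(\<Sum>k\<in>UNIV. trace_part a p i j k k) = 5 * a * kdelta i j + 7 * p i j"
proof -
  have "p 3 3 = - p 1 1 - p 2 2"
    using assms(2) by (simp add: trace2_def sum_3)
  then have "\<forall>i j. (\<Sum>k\<in>UNIV. trace_part a p i j k k) = 5 * a * kdelta i j + 7 * p i j"
    unfolding trace_part_def sum_3
    by (simp add: forall_3 kdelta_def assms(1)[of 2 1] assms(1)[of 3 1] assms(1)[of 3 2])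
  then show ?thesis by blast
qed

text \<open>
  \<open>R4 C\<close> is \<open>S4 C\<close> minus the trace part that has the same trace, so it is traceless, hence
  orthogonal to this trace part; the identity is Pythagoras' theorem.
\<close>

lemma Z7_eq:
  assumes "C \<in> elasticity_tensors"
  shows "Z7 C = inner4 (S4 C) (S4 C) - 1/5 * Z1 C - 6/7 * Z4 C"
proof -
  let ?g = "trace_part (S0 C / 15) (\<lambda>i j. P2 C i j / 7)"
  have P: "P2 C i j = P2 C j i" for i j
    using S4_sym[OF assms] by (simp add: P2_def S2_def kdelta_def)
  then have P': "(\<lambda>i j. P2 C i j / 7) i j = (\<lambda>i j. P2 C i j / 7) j i" for i j
    by simp
  have trP: "trace2 (P2 C) = 0"
    by (simp add: trace2_def P2_def S0_def sum_3 kdelta_def field_simps)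
  then have trP': "trace2 (\<lambda>i j. P2 C i j / 7) = 0"
    by (simp add: trace2_def sum_divide_distrib[symmetric])
  have S2: "(\<Sum>k\<in>UNIV. S4 C i j k k) = P2 C i j + S0 C / 3 * kdelta i j" for i j
    by (simp add: P2_def S2_def)
  have tr_g: "(\<Sum>k\<in>UNIV. ?g i j k k) = (\<Sum>k\<in>UNIV. S4 C i j k k)" for i j
    unfolding trace_trace_part[OF P' trP'] S2 by simp
  have g_sym: "?g i j k l = ?g j i k l" "?g i j k l = ?g i k j l" "?g i j k l = ?g i j l k" for i j k l
    using P[of i j] P[of i k] P[of i l] P[of j k] P[of j l] P[of k l]
    by (auto simp: trace_part_def kdelta_def)
  \<comment> \<open>Pairing a totally symmetric tensor with \<open>?g\<close> depends only on its
    trace, and \<open>?g\<close> and \<open>S4 C\<close> have the same trace.\<close>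
  have "inner4 ?g ?g = inner4 (S4 C) ?g"
    unfolding inner4_trace_part[of ?g, OF g_sym P'] inner4_trace_part[of "S4 C", OF S4_sym[OF assms] P'] tr_g ..
  moreover have "inner4 (S4 C) ?g = 1/5 * Z1 C + 6/7 * Z4 C"
  proof -
    have "trace2 (\<lambda>i j. P2 C i j + S0 C / 3 * kdelta i j) = S0 C"
      using trP by (simp add: trace2_def sum_3 kdelta_def)
    moreover have "inner2 (\<lambda>i j. P2 C i j + S0 C / 3 * kdelta i j) (\<lambda>i j. P2 C i j / 7) =
        (inner2 (P2 C) (P2 C) + S0 C / 3 * trace2 (P2 C)) / 7"
      by (simp add: inner2_def trace2_def sum_3 kdelta_def field_simps)
    ultimately show ?thesis
      unfolding inner4_trace_part[of "S4 C", OF S4_sym[OF assms] P'] S2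
      using trP by (simp add: Z1_def Z4_def inner2_def power2_eq_square)
  qed
  moreover have "Z7 C = inner4 (S4 C) (S4 C) - 2 * inner4 (S4 C) ?g + inner4 ?g ?g"
  proof -
    have "R4 C i j k l = S4 C i j k l - ?g i j k l" for i j k l
      by (simp add: R4_def trace_part_def field_simps)
    then have "R4 C i j k l * R4 C i j k l =
        S4 C i j k l * S4 C i j k l - 2 * (S4 C i j k l * ?g i j k l) + ?g i j k l * ?g i j k l" for i j k l
      by (simp only:) (simp add: algebra_simps)
    then show ?thesis
      unfolding Z7_def inner4_def by (simp add: sum.distrib sum_subtractf sum_distrib_left)
  qed
  ultimately show ?thesis by simp
qed

lemma Z7_eq_basic:
  assumes "C \<in> elasticity_tensors"
  shows "Z7 C = 12/35 * basic1 C + (-22/35) * basic2 C + 13/35 * basic3 C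
    + (-10/7) * basic4 C + 16/7 * basic5 C + (-12/7) * basic6 C + basic7 C"
  using Z7_eq[OF assms] Z1_eq_basic[OF assms] Z4_eq_basic[OF assms] inner4_S4[OF assms] basic8_eq[OF assms]
  by (simp add: field_simps)

lemma quadratic_invariant_Z:
  "quadratic_invariant Z1" "quadratic_invariant Z2" "quadratic_invariant Z3" "quadratic_invariant Z4"
  "quadratic_invariant Z5" "quadratic_invariant Z6" "quadratic_invariant Z7"
  by ((subst quadratic_invariant_cong, erule Z1_eq_basic Z2_eq_basic Z3_eq_basic Z4_eq_basic
        Z5_eq_basic Z6_eq_basic Z7_eq_basic,
      intro quadratic_invariant_add quadratic_invariant_scale quadratic_invariant_basic)+)

section \<open>Completeness\<close>

definition Z_combination :: "(tensor4 \<Rightarrow> real) \<Rightarrow> bool" where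
  "Z_combination I \<longleftrightarrow>
    (\<exists>a1 a2 a3 a4 a5 a6 a7 :: real. \<forall>C\<in>elasticity_tensors.
       I C = a1 * Z1 C + a2 * Z2 C + a3 * Z3 C + a4 * Z4 C + a5 * Z5 C + a6 * Z6 C + a7 * Z7 C)"

lemma Z_combinationI:
  assumes "\<And>C. C \<in> elasticity_tensors \<Longrightarrow>
    I C = a1 * Z1 C + a2 * Z2 C + a3 * Z3 C + a4 * Z4 C + a5 * Z5 C + a6 * Z6 C + a7 * Z7 C"
  shows "Z_combination I"
  using assms unfolding Z_combination_def by blast

lemma Z_combination_scale_add:
  assumes "Z_combination I" "Z_combination J"
  shows "Z_combination (\<lambda>C. c * I C + J C)"
proof -
  obtain a1 a2 a3 a4 a5 a6 a7 where I: "\<forall>C\<in>elasticity_tensors.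
      I C = a1 * Z1 C + a2 * Z2 C + a3 * Z3 C + a4 * Z4 C + a5 * Z5 C + a6 * Z6 C + a7 * Z7 C"
    using assms(1) unfolding Z_combination_def by blast
  obtain b1 b2 b3 b4 b5 b6 b7 where J: "\<forall>C\<in>elasticity_tensors.
      J C = b1 * Z1 C + b2 * Z2 C + b3 * Z3 C + b4 * Z4 C + b5 * Z5 C + b6 * Z6 C + b7 * Z7 C"
    using assms(2) unfolding Z_combination_def by blast
  show ?thesis
    by (rule Z_combinationI[of _ "c * a1 + b1" "c * a2 + b2" "c * a3 + b3" "c * a4 + b4"
        "c * a5 + b5" "c * a6 + b6" "c * a7 + b7"]) (simp add: I J algebra_simps)
qed

lemma Z_combination_sum:
  assumes "finite A" "\<And>x. x \<in> A \<Longrightarrow> Z_combination (F x)"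
  shows "Z_combination (\<lambda>C. \<Sum>x\<in>A. c x * F x C)"
  using assms
proof (induction rule: finite_induct)
  case empty
  show ?case
    by (rule Z_combinationI[of _ 0 0 0 0 0 0 0]) simp
next
  case (insert x A)
  then show ?case
    by (simp add: Z_combination_scale_add)
qed

lemma Z_combination_basic_invariant:
  assumes "basic_invariant I"
  shows "Z_combination I"
proof -
  note Z_eq = Z1_eq_basic Z2_eq_basic Z3_eq_basic Z4_eq_basic Z5_eq_basic Z6_eq_basic Z7_eq_basic
  \<comment> \<open>The witnesses invert the linear system that expresses the Z in
    \<open>basic1\<close> to \<open>basic7\<close>; for \<open>basic8\<close> the three-dimensional
    relation \<open>basic8_eq\<close> is used as well.\<close>
  have "Z_combination basic1"
    by (rule Z_combinationI[of _ 1 4 4 0 0 0 0]) (simp add: Z_eq)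
  moreover have "Z_combination basic2"
    by (rule Z_combinationI[of _ 1 1 "-2" 0 0 0 0]) (simp add: Z_eq)
  moreover have "Z_combination basic3"
    by (rule Z_combinationI[of _ 1 "-2" 1 0 0 0 0]) (simp add: Z_eq)
  moreover have "Z_combination basic4"
    by (rule Z_combinationI[of _ "1/3" "4/3" "4/3" 1 "-2" 1 0]) (simp add: Z_eq field_simps)
  moreover have "Z_combination basic5"
    by (rule Z_combinationI[of _ "1/3" "1/3" "-2/3" 1 "-1/2" "-1/2" 0]) (simp add: Z_eq field_simps)
  moreover have "Z_combination basic6"
    by (rule Z_combinationI[of _ "1/3" "-2/3" "1/3" 1 1 "1/4" 0]) (simp add: Z_eq field_simps)
  moreover have "Z_combination basic7"
    by (rule Z_combinationI[of _ "1/5" 0 1 "6/7" 0 3 1]) (simp add: Z_eq field_simps)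
  moreover have "Z_combination basic8"
    by (rule Z_combinationI[of _ "1/5" 0 "-1/2" "6/7" 0 "-3/2" 1]) (simp add: Z_eq basic8_eq field_simps)
  ultimately have "\<forall>B\<in>{basic1, basic2, basic3, basic4, basic5, basic6, basic7, basic8}. Z_combination B"
    by simp
  then show ?thesis
    using assms unfolding basic_invariant_def Z_combination_def by fastforce
qed

lemma Z_combination_quadratic_invariant:
  assumes "quadratic_invariant I"
  shows "Z_combination I"
proof -
  obtain c where I: "\<forall>C\<in>elasticity_tensors.
      I C = (\<Sum>\<sigma> | \<sigma> permutes {..<8}. c \<sigma> * contract (delta_product \<sigma>) C)"
    using assms unfolding quadratic_invariant_iff by blast
  have "Z_combination (\<lambda>C. \<Sum>\<sigma> | \<sigma> permutes {..<8}. c \<sigma> * contract (delta_product \<sigma>) C)"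
    by (intro Z_combination_sum finite_permutations finite_lessThan Z_combination_basic_invariant
        basic_invariant_contract_delta_product) simp
  then show ?thesis
    using I by (simp add: Z_combination_def)
qed

section \<open>Linear independence\<close>

definition sym_product :: "tensor2 \<Rightarrow> tensor2 \<Rightarrow> tensor4" where
  "sym_product u w i j k l = u i j * w k l + w i j * u k l"

text \<open>For \<open>a = b\<close> the single nonzero entry is 1, not 2.\<close>

definition sym_unit :: "3 \<Rightarrow> 3 \<Rightarrow> tensor2" where
  "sym_unit a b i j = (if (i, j) = (a, b) \<or> (i, j) = (b, a) then 1 else 0)"

lemma Z_independent:
  assumes "\<forall>C\<in>elasticity_tensors.
     a1 * Z1 C + a2 * Z2 C + a3 * Z3 C + a4 * Z4 C + a5 * Z5 C + a6 * Z6 C + a7 * Z7 C = 0"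
  shows "a1 = 0 \<and> a2 = 0 \<and> a3 = 0 \<and> a4 = 0 \<and> a5 = 0 \<and> a6 = 0 \<and> a7 = 0"
proof -
  note Z_eq = Z1_eq_basic Z2_eq_basic Z3_eq_basic Z4_eq_basic Z5_eq_basic Z6_eq_basic Z7_eq_basic
  have "sym_product u w \<in> elasticity_tensors" if "\<And>i j. u i j = u j i" "\<And>i j. w i j = w j i" for u w
    using that by (simp add: elasticity_tensors_def sym_product_def)
  moreover have "sym_unit a b i j = sym_unit a b j i" "kdelta i j = kdelta j i" for a b i j
    by (auto simp: sym_unit_def kdelta_def)
  ultimately have mem: "sym_product (sym_unit a b) (sym_unit c d) \<in> elasticity_tensors"
      "sym_product (sym_unit a b) kdelta \<in> elasticity_tensors"
      "sym_product kdelta kdelta \<in> elasticity_tensors" for a b c d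
    by blast+
  note eval = basic1_def basic2_def basic3_def basic4_def basic5_def basic6_def basic7_def
    inner4_def inner2_def trace2_def dilatation_def voigt_def sum_3 sym_product_def sym_unit_def kdelta_def
  \<comment> \<open>Seven test tensors give seven linear equations with only the zero solution. This
    tensor and the third one are totally symmetric, so \<open>A4\<close> vanishes and only
    \<open>Z1\<close>, \<open>Z4\<close>, \<open>Z7\<close> can contribute.\<close>
  have "4 * a1 + 8/3 * a4 + 32/35 * a7 = 0"
    using bspec[OF assms mem(1)[of 1 1 1 1]] unfolding Z_eq[OF mem(1)] by (simp add: eval)
  moreover have "4/9 * a1 + 4/9 * a2 + 4/9 * a3 + 2/27 * a4 - 4/27 * a5 + 8/27 * a6 + 18/35 * a7 = 0"
    using bspec[OF assms mem(1)[of 1 1 2 2]] unfolding Z_eq[OF mem(1)] by (simp add: eval)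
  moreover have "2 * a4 + 16/7 * a7 = 0"
    using bspec[OF assms mem(1)[of 1 1 1 2]] unfolding Z_eq[OF mem(1)] by (simp add: eval)
  moreover have "2/9 * a4 - 4/9 * a5 + 8/9 * a6 + 8/7 * a7 = 0"
    using bspec[OF assms mem(1)[of 1 1 2 3]] unfolding Z_eq[OF mem(1)] by (simp add: eval)
  \<comment> \<open>The total symmetrisation of a product with \<open>kdelta\<close> is a pure trace
    part, hence \<open>R4\<close> vanishes and \<open>a7\<close> is absent.\<close>
  moreover have "100/9 * a1 + 40/9 * a2 + 16/9 * a3 + 98/27 * a4 - 28/27 * a5 + 8/27 * a6 = 0"
    using bspec[OF assms mem(2)[of 1 1]] unfolding Z_eq[OF mem(2)] by (simp add: eval)
  moreover have "64/9 * a1 - 32/9 * a2 + 16/9 * a3 + 32/27 * a4 + 32/27 * a5 + 32/27 * a6 + 288/35 * a7 = 0"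
    using bspec[OF assms mem(1)[of 1 2 1 2]] unfolding Z_eq[OF mem(1)] by (simp add: eval)
  \<comment> \<open>The isotropic tensor, for which \<open>P2\<close>, \<open>Q2\<close> and
    \<open>R4\<close> all vanish.\<close>
  moreover have "100 * a1 + 40 * a2 + 16 * a3 = 0"
    using bspec[OF assms mem(3)] unfolding Z_eq[OF mem(3)] by (simp add: eval)
  ultimately show ?thesis
    by (intro conjI) linarith+
qed

theorem mainTheorem2:
  "(quadratic_invariant Z1 \<and> quadratic_invariant Z2 \<and> quadratic_invariant Z3 \<and>
    quadratic_invariant Z4 \<and> quadratic_invariant Z5 \<and> quadratic_invariant Z6 \<and>
    quadratic_invariant Z7) \<and>
   (\<forall>I. quadratic_invariant I \<longrightarrow>
     (\<exists>a1 a2 a3 a4 a5 a6 a7 :: real. \<forall>C\<in>elasticity_tensors.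
       I C = a1 * Z1 C + a2 * Z2 C + a3 * Z3 C + a4 * Z4 C
             + a5 * Z5 C + a6 * Z6 C + a7 * Z7 C)) \<and>
   (\<forall>a1 a2 a3 a4 a5 a6 a7 :: real.
     (\<forall>C\<in>elasticity_tensors.
       a1 * Z1 C + a2 * Z2 C + a3 * Z3 C + a4 * Z4 C
       + a5 * Z5 C + a6 * Z6 C + a7 * Z7 C = 0) \<longrightarrow>
     a1 = 0 \<and> a2 = 0 \<and> a3 = 0 \<and> a4 = 0 \<and> a5 = 0 \<and> a6 = 0 \<and> a7 = 0)"
  using quadratic_invariant_Z Z_combination_quadratic_invariant Z_independent
  unfolding Z_combination_def by (intro conjI allI impI) blast+

end
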